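(* Let $q$ be a prime power, let $n$ and $m\ge3$ be positive integers, and let $I,J,I_0,J_0$ be nonnegative integers with $J+J_0<n$, $I<J$ and $I_0<J_0$. Let $\mathbf{A}=(\alpha_1,\dots,\alpha_m)$ and $\overline{\mathbf{A}}=(\overline{\alpha_1},\dots,\overline{\alpha_m})$ with all entries in $\mathbb{F}_{q^n}^*$. If $(I,J)\ne(I_0,J_0)$, then $U^{I,J}_{\mathbf{A}}$ and $U^{I_0,J_0}_{\overline{\mathbf{A}}}$ are not $\Gamma\mathrm{L}(2m,q^n)$-equivalent.
   Context: For nonnegative integers $I<J<n$ and $\mathbf{A}=(\alpha_1,\dots,\alpha_m)\in(\mathbb{F}_{q^n}^* )^m$, $U^{I,J}_{\mathbf{A}}:=\{(x_1,\dots,x_m,f_1(\underline{x}),\dots,f_m(\underline{x})): x_1,\dots,x_m\in\mathbb{F}_{q^n}\}\subseteq\mathbb{F}_{q^n}^{2m}$, where $f_i(\underline{x})=x_i^{q^I}+\alpha_{i+1}x_{i+1}^{q^J}$ for $i=1,\dots,m-1$ and $f_m(\underline{x})=x_m^{q^I}+\alpha_1x_1^{q^J}$. Two $\mathbb{F}_q$-subspaces $U,U'\subseteq\mathbb{F}_{q^n}^{2m}$ are $\Gamma\mathrm{L}(2m,q^n)$-equivalent if there exist $M\in\mathrm{GL}(2m,q^n)$ and a field automorphism $\sigma$ of $\mathbb{F}_{q^n}$ such that $U'=\{M v^\sigma : v\in U\}$, where $\sigma$ acts entrywise on column vectors. *)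

theory Defs
  imports "Jordan_Normal_Form.Matrix" "HOL-Number_Theory.Prime_Powers" "HOL-Library.Cardinality"
begin

text \<open>
  The ambient field is a finite field type \<open>'a\<close> (of cardinality \<open>q ^ n\<close> in the theorem).
  Coordinates are numbered from \<open>0\<close>: the entry \<open>\<alpha>\<^sub>i\<close> of the parameter vector is \<open>A $ (i - 1)\<close>,
  and reducing \<open>i + 1\<close> modulo \<open>m\<close> produces the wrap-around
  \<open>f\<^sub>m(x) = x\<^sub>m^(q^I) + \<alpha>\<^sub>1 x\<^sub>1^(q^J)\<close>.
\<close>

definition f_map :: "nat \<Rightarrow> nat \<Rightarrow> nat \<Rightarrow> nat \<Rightarrow> 'a::{field,finite} vec \<Rightarrow> 'a vec \<Rightarrow> 'a vec" where
  "f_map q m I J A x =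
     vec m (\<lambda>i. x $ i ^ (q ^ I) + A $ ((i + 1) mod m) * x $ ((i + 1) mod m) ^ (q ^ J))"

definition U_set :: "nat \<Rightarrow> nat \<Rightarrow> nat \<Rightarrow> nat \<Rightarrow> 'a::{field,finite} vec \<Rightarrow> 'a vec set" where
  "U_set q m I J A = {x @\<^sub>v f_map q m I J A x | x. x \<in> carrier_vec m}"

definition field_automorphism :: "('a::field \<Rightarrow> 'a) \<Rightarrow> bool" where
  "field_automorphism \<sigma> \<longleftrightarrow> field_hom \<sigma> \<and> bij \<sigma>"

definition GammaL_equivalent :: "nat \<Rightarrow> 'a::field vec set \<Rightarrow> 'a vec set \<Rightarrow> bool" where
  "GammaL_equivalent d U U' \<longleftrightarrow>
     (\<exists>M \<sigma>. M \<in> carrier_mat d d \<and> invertible_mat M \<and> field_automorphism \<sigma> \<and>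
            U' = {M *\<^sub>v map_vec \<sigma> v | v. v \<in> U})"

end

theory Submission
  imports Defs "HOL-Number_Theory.Residues" "HOL-Computational_Algebra.Polynomial"
begin

text \<open>
  Absorbing the field automorphism into \<open>A\<close>, let the equivalence be given by an invertible block
  matrix with blocks \<open>P, Q, R, S\<close>. Restricting to vectors supported on a single coordinate turns
  the equivalence into identities between \<open>q\<close>-polynomials in one variable \<open>t\<close>, whose \<open>q\<close>-degrees
  are at most \<open>J + J\<^sub>0 < n\<close>; hence coefficients may be compared. The coefficient of
  \<open>t^(q^(J + J\<^sub>0))\<close> forces \<open>Q = 0\<close>. What remains is an identity between terms with exponents in
  \<open>{0, I, J}\<close> (with coefficients from \<open>R, S, S\<close>) and in \<open>{I\<^sub>0, J\<^sub>0}\<close> (with coefficients from \<open>P, P\<close>).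
  Unless \<open>(I, J) = (I\<^sub>0, J\<^sub>0)\<close>, one of the exponents is unmatched and forces \<open>S = 0\<close> or \<open>P = 0\<close>,
  contradicting invertibility.
\<close>

text \<open>The characteristic divides \<open>CARD('a)\<close>, a power of the prime under
  \<open>q\<close>, so it is that prime and \<open>q ^ k\<close> is a power of it.\<close>

lemma frobenius_power_add:
  fixes x y :: "'a::{field,finite}"
  assumes "primepow q" "CARD('a) = q ^ n"
  shows "(x + y) ^ (q ^ k) = x ^ (q ^ k) + y ^ (q ^ k)"
proof -
  obtain p e where p: "prime p" "q = p ^ e"
    using assms(1) by (auto simp: primepow_def)
  have prime: "prime CHAR('a)"
    using finite_imp_CHAR_pos[where ?'a = 'a] prime_CHAR_semidom[where ?'a = 'a] by simp
  have "CHAR('a) dvd p ^ (e * n)"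
    using CHAR_dvd_CARD[where ?'a = 'a] assms(2) p(2) by (simp add: power_mult)
  with prime have "CHAR('a) dvd p"
    using prime_dvd_power by blast
  with prime p(1) have "CHAR('a) = p"
    by (simp add: primes_dvd_imp_eq)
  then show ?thesis
    using freshmans_dream'[OF prime, of "q ^ k" "e * k" x y] p(2) by (simp add: power_mult)
qed

text \<open>The associated polynomial has degree at most \<open>q ^ (n - 1)\<close>, too small for
  all \<open>q ^ n\<close> field elements to be roots unless it vanishes. Since
  \<open>1 < q\<close>, distinct indices give distinct exponents.\<close>

lemma linearized_poly_coeffs_eq_0:
  fixes c :: "nat \<Rightarrow> 'a::{field,finite}"
  assumes "CARD('a) = q ^ n" and "1 < q"
    and zero: "\<And>t. (\<Sum>k<n. c k * t ^ (q ^ k)) = 0"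
    and "k < n"
  shows "c k = 0"
proof -
  define p where "p = (\<Sum>k<n. Polynomial.monom (c k) (q ^ k))"
  have "poly p t = 0" for t
    using zero[of t] by (simp add: p_def poly_sum poly_monom)
  then have roots: "{t. poly p t = 0} = UNIV"
    by auto
  have "Polynomial.degree p \<le> q ^ (n - 1)"
    unfolding p_def using \<open>1 < q\<close>
    by (intro degree_sum_le) (auto intro!: order.trans[OF Polynomial.degree_monom_le] power_increasing)
  also have "\<dots> < q ^ n"
    using \<open>1 < q\<close> \<open>k < n\<close> by (intro power_strict_increasing) auto
  finally have "p = 0"
    using card_poly_roots_bound[of p] roots assms(1) by fastforce
  moreover have "Polynomial.coeff p (q ^ k) = (\<Sum>i<n. if i = k then c i else 0)"
    unfolding p_def using \<open>1 < q\<close> by (auto simp: Polynomial.coeff_sum intro!: sum.cong)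
  ultimately show ?thesis
    using \<open>k < n\<close> by simp
qed

text \<open>Pads a single term to a full sum, the shape needed for comparing coefficients.\<close>

lemma sum_single_linearized:
  fixes b :: "'a::comm_semiring_1"
  assumes "e < n"
  shows "(\<Sum>k<n. (if k = e then b else 0) * t ^ (q ^ k)) = b * t ^ (q ^ e)"
proof -
  have "(\<Sum>k<n. (if k = e then b else 0) * t ^ (q ^ k))
      = (\<Sum>k<n. if k = e then b * t ^ (q ^ e) else 0)"
    by (intro sum.cong) auto
  with assms show ?thesis
    by simp
qed

lemma cyclic_succ_eq_iff:
  fixes m :: nat
  assumes "k < m" "l < m"
  shows "(k + 1) mod m = (l + 1) mod m \<longleftrightarrow> k = l"
  using assms by (auto simp: mod_Suc split: if_splits)

lemma cyclic_succ_surj: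
  fixes m :: nat
  assumes "j < m"
  obtains l where "l < m" "j = (l + 1) mod m"
proof (cases j)
  case 0
  with assms that[of "m - 1"] show ?thesis
    by simp
next
  case (Suc l)
  with assms that[of l] show ?thesis
    by simp
qed

lemma invertible_mat_row_nonzero:
  fixes M :: "'a::field mat"
  assumes "M \<in> carrier_mat d d" "invertible_mat M" "r < d"
  obtains k where "k < d" "M $$ (r, k) \<noteq> 0"
proof -
  obtain B where B: "M * B = 1\<^sub>m d" "B * M = 1\<^sub>m (dim_row B)"
    using assms by (auto simp: invertible_mat_def inverts_mat_def)
  have dims: "dim_col B = d" "dim_row B = d"
    using arg_cong[OF B(1), of dim_col] arg_cong[OF B(2), of dim_col] assms(1) by auto
  have "(M * B) $$ (r, r) = (\<Sum>k<d. M $$ (r, k) * B $$ (k, r))"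
    using assms dims by (auto simp: scalar_prod_def lessThan_atLeast0 intro!: sum.cong)
  with B(1) assms(3) have "(\<Sum>k<d. M $$ (r, k) * B $$ (k, r)) \<noteq> 0"
    by simp
  then obtain k where "k \<in> {..<d}" "M $$ (r, k) * B $$ (k, r) \<noteq> 0"
    by (rule sum.not_neutral_contains_not_neutral)
  then show ?thesis
    using that by auto
qed

lemma invertible_mat_col_nonzero:
  fixes M :: "'a::field mat"
  assumes "M \<in> carrier_mat d d" "invertible_mat M" "k < d"
  obtains r where "r < d" "M $$ (r, k) \<noteq> 0"
proof -
  obtain B where B: "M * B = 1\<^sub>m d" "B * M = 1\<^sub>m (dim_row B)"
    using assms by (auto simp: invertible_mat_def inverts_mat_def)
  have dims: "dim_col B = d" "dim_row B = d"
    using arg_cong[OF B(1), of dim_col] arg_cong[OF B(2), of dim_col] assms(1) by auto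
  have "(B * M) $$ (k, k) = (\<Sum>r<d. B $$ (k, r) * M $$ (r, k))"
    using assms dims by (auto simp: scalar_prod_def lessThan_atLeast0 intro!: sum.cong)
  with B(2) dims assms(3) have "(\<Sum>r<d. B $$ (k, r) * M $$ (r, k)) \<noteq> 0"
    by simp
  then obtain r where "r \<in> {..<d}" "B $$ (k, r) * M $$ (r, k) \<noteq> 0"
    by (rule sum.not_neutral_contains_not_neutral)
  then show ?thesis
    using that by auto
qed

lemma mult_mat_vec_single_coordinate:
  fixes M :: "'a::{field,finite} mat" and s :: 'a
  assumes M: "M \<in> carrier_mat (2 * m) (2 * m)" and \<sigma>: "field_hom \<sigma>"
    and q: "0 < q" and l: "l < m" and r: "r < 2 * m"
    and j: "j = (l + 1) mod m"
  defines "x \<equiv> vec m (\<lambda>k. if k = j then s else 0)"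
  shows "(M *\<^sub>v map_vec \<sigma> (x @\<^sub>v f_map q m I J A x)) $ r =
    M $$ (r, j) * \<sigma> s + M $$ (r, m + j) * \<sigma> s ^ (q ^ I)
      + M $$ (r, m + l) * \<sigma> (A $ j) * \<sigma> s ^ (q ^ J)"
proof -
  interpret field_hom \<sigma> by (fact \<sigma>)
  define w where "w = map_vec \<sigma> (x @\<^sub>v f_map q m I J A x)"
  have jm: "j < m"
    using l j by simp
  have w1: "w $ k = (if k = j then \<sigma> s else 0)" if "k < m" for k
    using that by (simp add: w_def x_def f_map_def)
  \<comment> \<open>As a sum of two conditionals, this later collapses to one term each for columns
    \<open>m + j\<close> and \<open>m + l\<close>.\<close>
  have w2: "w $ (m + k) = (if k = j then \<sigma> s ^ (q ^ I) else 0)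
      + (if k = l then \<sigma> (A $ j) * \<sigma> s ^ (q ^ J) else 0)" if "k < m" for k
    using that q cyclic_succ_eq_iff[OF that l] jm
    by (auto simp: w_def x_def f_map_def hom_distribs j zero_power)
  have "(M *\<^sub>v w) $ r = (\<Sum>k<m + m. M $$ (r, k) * w $ k)"
    using M r by (auto simp: scalar_prod_def w_def x_def f_map_def lessThan_atLeast0 mult_2
        intro!: sum.cong)
  also have "\<dots> = (\<Sum>k<m. M $$ (r, k) * w $ k) + (\<Sum>k<m. M $$ (r, m + k) * w $ (m + k))"
    by (simp add: sum.nat_group lessThan_atLeast0 sum.atLeastLessThan_concat[of 0 m "m + m", symmetric]
        sum.shift_bounds_nat_ivl[of _ 0 m m, simplified] add.commute)
  also have "(\<Sum>k<m. M $$ (r, k) * w $ k) = (\<Sum>k<m. if k = j then M $$ (r, j) * \<sigma> s else 0)"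
    by (intro sum.cong) (auto simp: w1)
  also have "(\<Sum>k<m. M $$ (r, m + k) * w $ (m + k)) =
      (\<Sum>k<m. (if k = j then M $$ (r, m + j) * \<sigma> s ^ (q ^ I) else 0)
        + (if k = l then M $$ (r, m + l) * \<sigma> (A $ j) * \<sigma> s ^ (q ^ J) else 0))"
    by (intro sum.cong) (auto simp: w2 distrib_left mult.assoc)
  finally show ?thesis
    using jm l by (simp add: w_def sum.distrib add.assoc)
qed

text \<open>
  The coefficients of \<open>t^(q^k)\<close> for a vector supported on coordinate \<open>j = l + 1\<close>: there
  \<open>f\<^sub>j\<close> contributes at \<open>q^I\<close> and the cyclically preceding \<open>f\<^sub>l\<close> at \<open>q^J\<close>.
\<close>

lemma GammaL_equivalent_coeffs:
  fixes A A' :: "'a::{field,finite} vec"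
  assumes q: "primepow q" and card: "CARD('a) = q ^ n" and n: "J + J\<^sub>0 < n"
    and IJ: "I < J" and IJ0: "I\<^sub>0 < J\<^sub>0"
    and M: "M \<in> carrier_mat (2 * m) (2 * m)" and \<sigma>: "field_automorphism \<sigma>"
    and U: "U_set q m I\<^sub>0 J\<^sub>0 A' = {M *\<^sub>v map_vec \<sigma> v | v. v \<in> U_set q m I J A}"
    and l: "l < m" and i: "i < m" and k: "k < n"
  defines "j \<equiv> (l + 1) mod m" and "i' \<equiv> (i + 1) mod m"
  shows "(if k = 0 then M $$ (m + i, j) else 0)
      + (if k = I then M $$ (m + i, m + j) else 0)
      + (if k = J then M $$ (m + i, m + l) * \<sigma> (A $ j) else 0)
    = (if k = I\<^sub>0 then M $$ (i, j) ^ (q ^ I\<^sub>0) else 0)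
      + (if k = I + I\<^sub>0 then M $$ (i, m + j) ^ (q ^ I\<^sub>0) else 0)
      + (if k = J + I\<^sub>0 then (M $$ (i, m + l) * \<sigma> (A $ j)) ^ (q ^ I\<^sub>0) else 0)
      + (if k = J\<^sub>0 then A' $ i' * M $$ (i', j) ^ (q ^ J\<^sub>0) else 0)
      + (if k = I + J\<^sub>0 then A' $ i' * M $$ (i', m + j) ^ (q ^ J\<^sub>0) else 0)
      + (if k = J + J\<^sub>0 then A' $ i' * (M $$ (i', m + l) * \<sigma> (A $ j)) ^ (q ^ J\<^sub>0) else 0)"
    (is "?L k = ?R k")
proof -
  have q1: "1 < q"
    using q primepow_gt_Suc_0 by auto
  have hom: "field_hom \<sigma>" and surj: "surj \<sigma>"
    using \<sigma> by (auto simp: field_automorphism_def bij_def)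
  have i': "i' < m"
    using i by (simp add: i'_def)
  \<comment> \<open>\<open>F r t\<close> is entry \<open>r\<close> of the image vector, with
    \<open>t\<close> standing for \<open>\<sigma> s\<close>. The exponent \<open>q ^ 0\<close> makes
    the linear term fit \<open>sum_single_linearized\<close>.\<close>
  define F where "F r t = M $$ (r, j) * t ^ (q ^ 0) + M $$ (r, m + j) * t ^ (q ^ I)
      + (M $$ (r, m + l) * \<sigma> (A $ j)) * t ^ (q ^ J)" for r t
  have F_eq: "F (m + i) t = F i t ^ (q ^ I\<^sub>0) + A' $ i' * F i' t ^ (q ^ J\<^sub>0)" for t
  proof -
    \<comment> \<open>Surjectivity of \<open>\<sigma>\<close> yields the identity at every field
      element, as the root count requires.\<close>
    obtain s where s: "t = \<sigma> s"
      using surj by auto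
    define x where "x = vec m (\<lambda>k. if k = j then s else 0)"
    define v where "v = x @\<^sub>v f_map q m I J A x"
    have "v \<in> U_set q m I J A"
      unfolding U_set_def v_def x_def by auto
    then have "M *\<^sub>v map_vec \<sigma> v \<in> U_set q m I\<^sub>0 J\<^sub>0 A'"
      using U by blast
    then obtain y where y: "y \<in> carrier_vec m" "M *\<^sub>v map_vec \<sigma> v = y @\<^sub>v f_map q m I\<^sub>0 J\<^sub>0 A' y"
      unfolding U_set_def by auto
    have row: "(y @\<^sub>v f_map q m I\<^sub>0 J\<^sub>0 A' y) $ r = F r t" if "r < 2 * m" for r
      using mult_mat_vec_single_coordinate[OF M hom _ l that j_def[THEN meta_eq_to_obj_eq],
          of q s I J A] q1
      by (simp add: F_def s y(2)[symmetric] v_def x_def)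
    have "y $ r = F r t" if "r < m" for r
      using row[of r] that y(1) by (simp add: f_map_def)
    moreover have "y $ i ^ (q ^ I\<^sub>0) + A' $ i' * y $ i' ^ (q ^ J\<^sub>0) = F (m + i) t"
      using row[of "m + i"] i y(1) by (simp add: f_map_def i'_def)
    ultimately show ?thesis
      using i i' by simp
  qed
  have F_pow: "F r t ^ (q ^ e) = M $$ (r, j) ^ (q ^ e) * t ^ (q ^ e)
      + M $$ (r, m + j) ^ (q ^ e) * t ^ (q ^ (I + e))
      + (M $$ (r, m + l) * \<sigma> (A $ j)) ^ (q ^ e) * t ^ (q ^ (J + e))" for r t e
    unfolding F_def
    by (simp add: frobenius_power_add[OF q card] power_mult_distrib power_add flip: power_mult)
  \<comment> \<open>All exponents stay below \<open>n\<close>, so no reduction by t^(q^n) = t can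
    merge terms.\<close>
  have exps: "0 < n" "I < n" "J < n" "I\<^sub>0 < n" "I + I\<^sub>0 < n" "J + I\<^sub>0 < n"
    "J\<^sub>0 < n" "I + J\<^sub>0 < n" "J + J\<^sub>0 < n"
    using n IJ IJ0 by auto
  have "(\<Sum>k<n. (?L k - ?R k) * t ^ (q ^ k)) = 0" for t
  proof -
    have "F (m + i) t = (\<Sum>k<n. ?L k * t ^ (q ^ k))"
      unfolding F_def by (simp only: distrib_right sum.distrib sum_single_linearized exps)
    moreover have "F i t ^ (q ^ I\<^sub>0) + A' $ i' * F i' t ^ (q ^ J\<^sub>0) = (\<Sum>k<n. ?R k * t ^ (q ^ k))"
      unfolding F_pow
      by (simp only: distrib_right distrib_left sum.distrib sum_single_linearized exps)
        (simp only: ac_simps)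
    ultimately show ?thesis
      using F_eq[of t] by (simp only: left_diff_distrib sum_subtractf) simp
  qed
  from linearized_poly_coeffs_eq_0[OF card q1 this k] show ?thesis
    by simp
qed

theorem mainTheorem11:
  fixes q n m I J I\<^sub>0 J\<^sub>0 :: nat
    and A A' :: "'a::{field,finite} vec"
  assumes "primepow q"
    and "n \<ge> 1"
    and "m \<ge> 3"
    and "CARD('a) = q ^ n"
    and "J + J\<^sub>0 < n"
    and "I < J"
    and "I\<^sub>0 < J\<^sub>0"
    and "A \<in> carrier_vec m" and "\<forall>i<m. A $ i \<noteq> 0"
    and "A' \<in> carrier_vec m" and "\<forall>i<m. A' $ i \<noteq> 0"
    and "(I, J) \<noteq> (I\<^sub>0, J\<^sub>0)"
  shows "\<not> GammaL_equivalent (2 * m) (U_set q m I J A) (U_set q m I\<^sub>0 J\<^sub>0 A')"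
proof
  assume "GammaL_equivalent (2 * m) (U_set q m I J A) (U_set q m I\<^sub>0 J\<^sub>0 A')"
  then obtain M \<sigma> where M: "M \<in> carrier_mat (2 * m) (2 * m)" and inv: "invertible_mat M"
    and \<sigma>: "field_automorphism \<sigma>"
    and U: "U_set q m I\<^sub>0 J\<^sub>0 A' = {M *\<^sub>v map_vec \<sigma> v | v. v \<in> U_set q m I J A}"
    unfolding GammaL_equivalent_def by auto
  interpret field_hom \<sigma>
    using \<sigma> by (simp add: field_automorphism_def)
  note coeffs = GammaL_equivalent_coeffs[OF assms(1,4,5,6,7) M \<sigma> U]
  have q: "q > 0"
    using assms(1) primepow_gt_Suc_0[of q] by auto
  have m: "m > 0"
    using assms(3) by simp
  have A: "\<sigma> (A $ ((l + 1) mod m)) \<noteq> 0" and A': "A' $ ((l + 1) mod m) \<noteq> 0" for l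
    using assms(9,11) m by auto

  \<comment> \<open>The exponent \<open>J + J\<^sub>0\<close> strictly exceeds all others, so its
    only coefficient, with nonzero factors from \<open>A\<close> and \<open>A'\<close>, is 0. It
    involves the row after \<open>h\<close>, hence the cyclic predecessor of
    \<open>i\<close>.\<close>
  have Q: "M $$ (i, m + l) = 0" if "i < m" "l < m" for i l
  proof -
    obtain h where h: "h < m" "i = (h + 1) mod m"
      using \<open>i < m\<close> by (rule cyclic_succ_surj)
    show ?thesis
      using coeffs[OF \<open>l < m\<close> h(1) assms(5)] assms(6,7) A[of l] A'[of h] q
      by (simp add: h(2))
  qed
  \<comment> \<open>As the upper right block is zero, a zero column in the lower right block is a
    zero column of \<open>M\<close>; likewise for rows of the upper left block in
    \<open>P\<close>.\<close>
  have S: False if "\<And>i. i < m \<Longrightarrow> M $$ (m + i, m + l) = 0" "l < m" for l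
  proof -
    obtain r where r: "r < 2 * m" "M $$ (r, m + l) \<noteq> 0"
      using invertible_mat_col_nonzero[OF M inv, of "m + l"] \<open>l < m\<close> by auto
    then show False
      using Q[of r l] that(1)[of "r - m"] \<open>l < m\<close> by (cases "r < m") (auto simp: less_diff_conv2)
  qed
  have P: False if "\<And>j. j < m \<Longrightarrow> M $$ (i, j) = 0" "i < m" for i
  proof -
    obtain k where k: "k < 2 * m" "M $$ (i, k) \<noteq> 0"
      using invertible_mat_row_nonzero[OF M inv, of i] \<open>i < m\<close> by auto
    then show False
      using Q[of i "k - m"] that(1)[of k] \<open>i < m\<close> by (cases "k < m") (auto simp: less_diff_conv2)
  qed
  have coeff: "(if k = 0 then M $$ (m + i, (l + 1) mod m) else 0)
      + (if k = I then M $$ (m + i, m + (l + 1) mod m) else 0)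
      + (if k = J then M $$ (m + i, m + l) * \<sigma> (A $ ((l + 1) mod m)) else 0)
    = (if k = I\<^sub>0 then M $$ (i, (l + 1) mod m) ^ (q ^ I\<^sub>0) else 0)
      + (if k = J\<^sub>0 then A' $ ((i + 1) mod m) * M $$ ((i + 1) mod m, (l + 1) mod m) ^ (q ^ J\<^sub>0)
         else 0)"
    if "l < m" "i < m" "k < n" for l i k
    using coeffs[OF that] Q[of i] Q[of "(i + 1) mod m"] that m q
    by (simp add: zero_power del: add_Suc_right cong: if_cong)

  \<comment> \<open>On the left \<open>J\<close> differs from 0 and \<open>I\<close>; unmatched on
    the right, it would kill a column of the lower right block.\<close>
  have "J = I\<^sub>0 \<or> J = J\<^sub>0"
  proof (rule ccontr)
    assume "\<not> ?thesis"
    then have "M $$ (m + i, m + 0) = 0" if "i < m" for i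
      using coeff[OF m that, of J] A[of 0] assms(5,6) by auto
    then show False
      using S m by blast
  qed
  moreover have "J\<^sub>0 = I \<or> J\<^sub>0 = J"
  proof (rule ccontr)
    assume neg: "\<not> ?thesis"
    have "M $$ ((0 + 1) mod m, j) = 0" if "j < m" for j
    proof -
      obtain l where "l < m" "j = (l + 1) mod m"
        using \<open>j < m\<close> by (rule cyclic_succ_surj)
      then show ?thesis
        using coeff[OF \<open>l < m\<close> m, of J\<^sub>0] neg A'[of 0] assms(5,7) by auto
    qed
    then show False
      using P m mod_less_divisor by blast
  qed
  \<comment> \<open>The alternative \<open>J = I\<^sub>0\<close> would give
    \<open>J < J\<^sub>0\<close>, whereas \<open>J\<^sub>0\<close> is \<open>I\<close> or
    \<open>J\<close>.\<close>
  ultimately have JJ: "J = J\<^sub>0"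
    using assms(6,7) by auto
  then have II: "I \<noteq> I\<^sub>0"
    using assms(12) by simp
  show False
  \<comment> \<open>For \<open>I = 0\<close> the first two left terms share an exponent and
    \<open>I\<close> no longer isolates an entry. Then \<open>I\<^sub>0\<close> is positive and
    unmatched on the left, so a row of the upper left block vanishes instead.\<close>
  proof (cases "I = 0")
    case False
    have "M $$ (m + i, m + (0 + 1) mod m) = 0" if "i < m" for i
      using coeff[OF m that, of I] False II JJ assms(5,6) by auto
    then show False
      using S m mod_less_divisor by blast
  next
    case True
    have "M $$ (0, j) = 0" if "j < m" for j
    proof -
      obtain l where "l < m" "j = (l + 1) mod m"
        using \<open>j < m\<close> by (rule cyclic_succ_surj)
      then show ?thesis
        using coeff[OF \<open>l < m\<close> m, of I\<^sub>0] True II JJ assms(5,7) by auto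
    qed
    then show False
      using P m by blast
  qed
qed

end
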